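(* Let $q\in\mathbb C$ with $0<|q|<1$ and let $\alpha,a,b,c,d\in\mathbb C\setminus\{0\}$ with $|abcd|<|q|^{-1}$. Then $$\int_{-\infty}^\infty(1+q^{2x}\alpha^2)\prod_{t\in\{a,b,c,d\}}\Big(-q^{x+1}\alpha t,\frac{q^{1-x}t}{\alpha};q\Big)_\infty\;q^{2x^2-x}\alpha^{4x}\,dx$$ $$=\frac{\sqrt{2\pi}\,\alpha\,\exp\left(\frac{2(\log\alpha)^2}{\log q^{-1}}\right)(-qab,-qac,-qad,-qbc,-qbd,-qcd;q)_\infty}{q^{1/8}\sqrt{\log q^{-1}}\,(qabcd;q)_\infty},$$ where $\{a,b,c,d\}$ is a multiset (so the product has one factor for each of the four parameters).
   Context: Notation: $(y;q)_\infty=\prod_{j\ge0}(1-yq^j)$ and $(y_1,\dots,y_r;q)_\infty=\prod_i(y_i;q)_\infty$. Powers are $q^s=\exp(s\log q)$, $\alpha^{s}=\exp(s\log\alpha)$ with principal logarithms, $\log q^{-1}=-\log q$ (which has positive real part), and $\sqrt{\log q^{-1}}$ is the principal square root. *)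

theory Defs
  imports "HOL-Analysis.Analysis"
begin

definition qpoch_inf :: "complex \<Rightarrow> complex \<Rightarrow> complex" where
  "qpoch_inf y q = (\<Prod>j. 1 - y * q ^ j)"

definition qpochs_inf :: "complex list \<Rightarrow> complex \<Rightarrow> complex" where
  "qpochs_inf ys q = (\<Prod>y\<leftarrow>ys. qpoch_inf y q)"

text \<open>
  Complex powers are written with \<^const>\<open>powr\<close>, i.e. \<open>z powr s = exp (s * Ln z)\<close> for \<open>z \<noteq> 0\<close> with
  the principal logarithm. The product over the multiset \<open>{a, b, c, d}\<close> is a multiset product, so
  coinciding parameters contribute repeated factors.
\<close>
definition integrand ::
    "complex \<Rightarrow> complex \<Rightarrow> complex \<Rightarrow> complex \<Rightarrow> complex \<Rightarrow> complex \<Rightarrow> real \<Rightarrow> complex" where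
  "integrand q \<alpha> a b c d x =
     (1 + q powr of_real (2 * x) * \<alpha>\<^sup>2) *
     (\<Prod>t\<in>#{#a, b, c, d#}.
        qpochs_inf [- (q powr of_real (x + 1) * \<alpha> * t), q powr of_real (1 - x) * t / \<alpha>] q) *
     q powr of_real (2 * x\<^sup>2 - x) * \<alpha> powr of_real (4 * x)"

text \<open>
  The quantity \<open>log q\<inverse>\<close> is understood as \<open>- log q\<close>; this differs from \<open>Ln (inverse q)\<close> when \<open>q\<close> is a
  negative real.
\<close>
definition log_inv :: "complex \<Rightarrow> complex" where
  "log_inv q = - Ln q"

end

theory Submission
  imports
    Defs
    "HOL-Complex_Analysis.Complex_Analysis"
    "HOL-Probability.Probability"
    "HOL-Real_Asymp.Real_Asymp"
begin

text \<open>
  Put \<open>z = \<alpha> q\<^sup>x\<close>, \<open>P\<^sub>t = (-qtz, qt/z; q)\<close> (infinite products) and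
  \<open>E = q powr (2x\<^sup>2) \<alpha> powr (4x)\<close>. Since \<open>q powr (-x) = \<alpha>/z\<close>, the integrand is
  \<open>\<alpha> (z + 1/z) E P\<^sub>a P\<^sub>b P\<^sub>c P\<^sub>d\<close>. Let \<open>f(a,b,c,d)\<close> be this function without the
  constant \<open>\<alpha>\<close> and \<open>F(a,b,c,d)\<close> its integral. The evaluation rests on the functional equation
  \<open>(1 - qabcd) F(a,b,c,d) = (1 + qab)(1 + qac)(1 + qad) F(qa,b,c,d)\<close>,
  which lets one parameter after the other be contracted to \<open>0\<close>.

  The functional equation (\<open>F_contiguous\<close>) comes from translation invariance of Lebesgue measure.
  Replacing \<open>x\<close> by \<open>x - 1\<close> replaces \<open>z\<close> by \<open>z/q\<close>, multiplies \<open>E\<close> by \<open>q\<^sup>2/z\<^sup>4\<close> and moves one linear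
  factor between the infinite products. Hence \<open>\<psi> = z\<^sup>2 E \<Prod>\<^sub>t (-qtz, t/z; q)\<close> satisfies
  \<open>\<psi>(x) - \<psi>(x - 1) = E P\<^sub>a P\<^sub>b P\<^sub>c P\<^sub>d (z\<^sup>2 \<Prod>\<^sub>t (1 - t/z) - z\<^sup>-\<^sup>2 \<Prod>\<^sub>t (1 + tz))\<close>,
  and the bracket is \<open>z + 1/z\<close> times an affine function of \<open>z - 1/z\<close>. As
  \<open>P\<^sub>a = (1 + qaz)(1 - qa/z) P\<^sub>q\<^sub>a\<close>, where the quadratic factor is also affine in \<open>z - 1/z\<close>, the
  difference for the parameters \<open>qa, b, c, d\<close> is a linear combination of \<open>f(a,b,c,d)\<close> and
  \<open>f(qa,b,c,d)\<close> (\<open>f_contiguous\<close>); it integrates to \<open>0\<close>.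

  Iterating and using dominated convergence as \<open>q\<^sup>n a\<close> tends to \<open>0\<close> gives \<open>F(0,b,c,d)\<close> with three infinite
  products (\<open>F_remove_parameter\<close>). By symmetry the other parameters are removed in the same way, and
  the six products of the result appear (\<open>F_eq\<close>). What remains is \<open>F(0,0,0,0)\<close>, the sum of two
  Gaussian integrals with complex variance and complex centre. They are obtained by analytic
  continuation from the real case (\<open>gaussian_integral_complex\<close>).

  Convergence is delicate because the four factors \<open>P\<^sub>t\<close> grow exactly as fast as the Gaussian \<open>E\<close>
  decays. What remains is geometric decay: the ratio of the values at \<open>x + 1\<close> and \<open>x\<close> tends to \<open>qabcd\<close>
  as \<open>x \<rightarrow> \<infinity>\<close>, and so does the inverse ratio as \<open>x \<rightarrow> -\<infinity>\<close>. So integrability is a ratio test, carried out for a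
  real majorant (\<open>integrable_gauss_maj\<close>) which also dominates all steps of the iteration.
\<close>

section \<open>The infinite q-Pochhammer symbol\<close>

lemma convergent_prod_qpoch:
  assumes "norm q < 1"
  shows "convergent_prod (\<lambda>j. 1 - y * q ^ j :: complex)"
proof (rule abs_convergent_prod_imp_convergent_prod, rule summable_imp_abs_convergent_prod)
  show "summable (\<lambda>j. norm (1 - y * q ^ j - 1))"
    using assms by (simp add: norm_mult norm_power summable_geometric summable_mult)
qed

lemma qpoch_inf_LIMSEQ:
  assumes "norm q < 1"
  shows "(\<lambda>n. \<Prod>j<n. 1 - y * q ^ j) \<longlonglongrightarrow> qpoch_inf y q"
  using convergent_prod_LIMSEQ[OF convergent_prod_qpoch[OF assms]]
  by (simp add: qpoch_inf_def LIMSEQ_lessThan_iff_atMost)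

lemma qpoch_inf_rec:
  assumes "norm q < 1"
  shows "qpoch_inf y q = (1 - y) * qpoch_inf (q * y) q"
proof (rule LIMSEQ_unique)
  show "(\<lambda>n. \<Prod>j<Suc n. 1 - y * q ^ j) \<longlonglongrightarrow> qpoch_inf y q"
    by (rule LIMSEQ_Suc[OF qpoch_inf_LIMSEQ[OF assms]])
  have "(\<lambda>n. (1 - y) * (\<Prod>j<n. 1 - q * y * q ^ j)) \<longlonglongrightarrow> (1 - y) * qpoch_inf (q * y) q"
    by (intro tendsto_intros qpoch_inf_LIMSEQ assms)
  also have "(\<lambda>n. (1 - y) * (\<Prod>j<n. 1 - q * y * q ^ j)) = (\<lambda>n. \<Prod>j<Suc n. 1 - y * q ^ j)"
    by (simp add: prod.lessThan_Suc_shift algebra_simps del: prod.lessThan_Suc)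
  finally show "(\<lambda>n. \<Prod>j<Suc n. 1 - y * q ^ j) \<longlonglongrightarrow> (1 - y) * qpoch_inf (q * y) q" .
qed

lemma qpoch_inf_zero [simp]: "qpoch_inf 0 q = 1"
  by (simp add: qpoch_inf_def)

lemma qpoch_inf_nonzero:
  assumes "norm q < 1" "norm y < 1"
  shows "qpoch_inf y q \<noteq> 0"
  unfolding qpoch_inf_def
proof (rule prodinf_nonzero[OF convergent_prod_qpoch[OF assms(1)]])
  fix j
  have "norm (y * q ^ j) \<le> norm y * 1"
    unfolding norm_mult norm_power using assms by (intro mult_left_mono power_le_one) auto
  then show "1 - y * q ^ j \<noteq> 0"
    using assms(2) by auto
qed

text \<open>
  By the Weierstrass M-test the partial products converge uniformly on every disc.
\<close>

lemma continuous_on_qpoch_inf: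
  assumes "norm q < 1"
  shows "continuous_on A (\<lambda>y. qpoch_inf y q)"
proof -
  have "continuous_on (ball 0 R) (\<lambda>y. qpoch_inf y q)" for R
  proof -
    have "uniformly_convergent_on (cball 0 R) (\<lambda>N y. \<Prod>n<N. 1 - y * q ^ n)"
    proof (rule uniformly_convergent_on_prod')
      show "uniformly_convergent_on (cball 0 R) (\<lambda>N y. \<Sum>n<N. norm (1 - y * q ^ n - 1))"
      proof (rule Weierstrass_m_test')
        show "norm (norm (1 - y * q ^ n - 1)) \<le> R * norm q ^ n" if "y \<in> cball 0 R" for n y
          using that by (simp add: norm_mult norm_power mult_right_mono)
        show "summable (\<lambda>n. R * norm q ^ n)"
          using assms by (intro summable_mult summable_geometric) auto
      qed
    qed (auto intro!: continuous_intros)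
    then obtain g where g: "uniform_limit (cball 0 R) (\<lambda>N y. \<Prod>n<N. 1 - y * q ^ n) g sequentially"
      by (auto simp: uniformly_convergent_on_def)
    have "g y = qpoch_inf y q" if "y \<in> cball 0 R" for y
      using tendsto_uniform_limitI[OF g that] qpoch_inf_LIMSEQ[OF assms] LIMSEQ_unique by blast
    moreover have "continuous_on (cball 0 R) g"
      by (rule uniform_limit_theorem[OF _ g]) (auto intro!: continuous_intros always_eventually)
    ultimately have "continuous_on (cball 0 R) (\<lambda>y. qpoch_inf y q)"
      by (metis (no_types, lifting) continuous_on_cong)
    then show ?thesis
      by (rule continuous_on_subset) auto
  qed
  then have "continuous_on (\<Union>R\<in>UNIV. ball 0 R) (\<lambda>y. qpoch_inf y q)"
    by (intro continuous_on_open_UN) auto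
  moreover have "(\<Union>R\<in>UNIV. ball 0 R) = (UNIV :: complex set)"
    by (auto intro: gt_ex)
  ultimately show ?thesis
    by (metis continuous_on_subset subset_UNIV)
qed

lemma continuous_on_qpoch_inf' [continuous_intros]:
  assumes "norm q < 1" "continuous_on A f"
  shows "continuous_on A (\<lambda>x. qpoch_inf (f x) q)"
  using continuous_on_compose2[OF continuous_on_qpoch_inf[OF assms(1)] assms(2)] by blast

lemma tendsto_qpoch_inf [tendsto_intros]:
  assumes "norm q < 1" "(f \<longlongrightarrow> y) F"
  shows "((\<lambda>x. qpoch_inf (f x) q) \<longlongrightarrow> qpoch_inf y q) F"
  using continuous_on_qpoch_inf[OF assms(1), of UNIV] assms(2)
  by (auto simp: continuous_on_eq_continuous_at intro: isCont_tendsto_compose)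

text \<open>
  For \<open>r = norm q\<close> this is the infinite product of the \<open>1 + s r\<^sup>j\<close>, the termwise upper bound of every
  \<open>norm (qpoch_inf y q)\<close> with \<open>norm y \<le> s\<close>. It is written as the norm of a complex symbol in order
  to inherit its continuity and its recursion.
\<close>

definition qpoch_maj :: "real \<Rightarrow> real \<Rightarrow> real" where
  "qpoch_maj r s = norm (qpoch_inf (- of_real s) (of_real r))"

lemma qpoch_maj_nonneg: "0 \<le> qpoch_maj r s"
  by (simp add: qpoch_maj_def)

lemma norm_qpoch_inf_le:
  assumes "norm q < 1" "norm y \<le> s"
  shows "norm (qpoch_inf y q) \<le> qpoch_maj (norm q) s"
proof (rule LIMSEQ_le)
  show "(\<lambda>n. norm (\<Prod>j<n. 1 - y * q ^ j)) \<longlonglongrightarrow> norm (qpoch_inf y q)"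
    by (intro tendsto_intros qpoch_inf_LIMSEQ assms)
  show "(\<lambda>n. norm (\<Prod>j<n. 1 - (- of_real s) * of_real (norm q) ^ j :: complex)) \<longlonglongrightarrow>
      qpoch_maj (norm q) s"
    unfolding qpoch_maj_def using assms by (intro tendsto_intros qpoch_inf_LIMSEQ) auto
  have "norm (1 - y * q ^ j) \<le> norm (1 - (- of_real s) * of_real (norm q) ^ j :: complex)" for j
  proof -
    have "norm (1 - y * q ^ j) \<le> norm (1::complex) + norm (y * q ^ j)"
      by (rule norm_triangle_ineq4)
    also have "\<dots> \<le> 1 + s * norm q ^ j"
      using assms by (simp add: norm_mult norm_power mult_right_mono)
    also have "\<dots> = norm (of_real (1 + s * norm q ^ j) :: complex)"
      using order_trans[OF norm_ge_zero assms(2)] by (subst norm_of_real) (simp add: add_nonneg_nonneg)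
    finally show ?thesis
      by simp
  qed
  then show "\<exists>N. \<forall>n\<ge>N. norm (\<Prod>j<n. 1 - y * q ^ j) \<le>
      norm (\<Prod>j<n. 1 - (- of_real s) * of_real (norm q) ^ j :: complex)"
    unfolding prod_norm[symmetric] by (intro exI[of _ 0] allI impI prod_mono) auto
qed

lemma qpoch_maj_rec:
  assumes "0 \<le> r" "r < 1" "0 \<le> s"
  shows "qpoch_maj r s = (1 + s) * qpoch_maj r (r * s)"
proof -
  have "norm (1 + of_real s :: complex) = 1 + s"
    using assms(3) by (metis abs_of_nonneg add_nonneg_nonneg norm_of_real of_real_1 of_real_add zero_le_one)
  then show ?thesis
    unfolding qpoch_maj_def using qpoch_inf_rec[of "of_real r" "- of_real s"] assms
    by (simp add: norm_mult)
qed

lemma continuous_on_qpoch_maj [continuous_intros]: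
  assumes "0 \<le> r" "r < 1" "continuous_on A f"
  shows "continuous_on A (\<lambda>x. qpoch_maj r (f x))"
  unfolding qpoch_maj_def using assms by (intro continuous_intros) auto

section \<open>Integrability from a ratio condition\<close>

text \<open>
  Every \<open>x \<ge> M\<close> is reached by unit steps from the compact interval \<open>[M, M + 1]\<close>, on which \<open>g\<close> is
  bounded, and each step gains a factor \<open>\<rho>\<close>.
\<close>

lemma geometric_decay_bound:
  fixes g :: "real \<Rightarrow> real"
  assumes cont: "continuous_on UNIV g" and nonneg: "\<And>x. 0 \<le> g x"
    and \<rho>: "0 < \<rho>" "\<rho> < 1" and ratio: "\<And>x. x \<ge> M \<Longrightarrow> g (x + 1) \<le> \<rho> * g x"
  shows "\<exists>C\<ge>0. \<forall>x\<ge>M. g x \<le> C * exp (ln \<rho> * x)"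
proof -
  have "\<exists>x\<in>{M..M+1}. \<forall>y\<in>{M..M+1}. g y \<le> g x"
    by (rule continuous_attains_sup) (use cont in \<open>auto intro: continuous_on_subset\<close>)
  then obtain x0 where x0: "\<And>y. y \<in> {M..M+1} \<Longrightarrow> g y \<le> g x0"
    by blast
  have iter: "g (y + real n) \<le> \<rho> ^ n * g y" if "y \<ge> M" for y n
  proof (induction n)
    case (Suc n)
    have "g (y + real n + 1) \<le> \<rho> * g (y + real n)"
      using that by (intro ratio) auto
    also have "\<dots> \<le> \<rho> * (\<rho> ^ n * g y)"
      using Suc \<rho> by (intro mult_left_mono) auto
    finally show ?case
      by (simp add: add_ac mult_ac)
  qed auto
  define C where "C = g x0 * exp (ln \<rho> * (- M - 1))"
  have "g x \<le> C * exp (ln \<rho> * x)" if "x \<ge> M" for x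
  proof -
    define n where "n = nat \<lfloor>x - M\<rfloor>"
    have n: "real n \<le> x - M" "x - M < real n + 1"
      using that by (auto simp: n_def)
    have "g x = g ((x - real n) + real n)"
      by simp
    also have "\<dots> \<le> \<rho> ^ n * g (x - real n)"
      using n by (intro iter) auto
    also have "\<dots> \<le> \<rho> ^ n * g x0"
      using n \<rho> by (intro mult_left_mono x0) auto
    also have "\<rho> ^ n = exp (ln \<rho> * real n)"
      using \<rho> by (simp add: exp_of_nat_mult mult.commute[of "ln \<rho>"])
    also have "\<dots> \<le> exp (ln \<rho> * (x - M - 1))"
      using n \<rho> by (auto intro!: mult_left_mono_neg)
    finally show ?thesis
      using nonneg[of x0] by (simp add: C_def mult_right_mono mult_ac flip: exp_add) (simp add: algebra_simps)
  qed
  moreover have "C \<ge> 0"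
    by (simp add: C_def nonneg)
  ultimately show ?thesis
    by blast
qed

lemma integrable_exp_neg_abs:
  fixes \<kappa> :: real
  assumes "\<kappa> > 0"
  shows "integrable lborel (\<lambda>x::real. exp (- \<kappa> * \<bar>x\<bar>))"
proof -
  let ?f = "\<lambda>x::real. exp (- \<kappa> * x)"
  have "(\<integral>\<^sup>+x. ennreal (?f x) * indicator {0..} x \<partial>lborel) = ennreal (0 - (- ?f 0 / \<kappa>))"
  proof (rule nn_integral_FTC_atLeast)
    show "DERIV (\<lambda>x. - ?f x / \<kappa>) x :> ?f x" for x
      using assms by (auto intro!: derivative_eq_intros)
    show "((\<lambda>x. - ?f x / \<kappa>) \<longlongrightarrow> 0) at_top"
      using assms by real_asymp
  qed auto
  then have "has_bochner_integral lborel (\<lambda>x. indicator {0..} x *\<^sub>R exp (- \<kappa> * \<bar>x\<bar>)) (0 - (- ?f 0 / \<kappa>))"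
    using assms
    by (intro has_bochner_integral_nn_integral)
       (auto simp: indicator_def cong: if_cong intro!: nn_integral_cong elim!: trans[rotated])
  then have "has_bochner_integral lborel (\<lambda>x. exp (- \<kappa> * \<bar>x\<bar>)) (2 *\<^sub>R (0 - (- ?f 0 / \<kappa>)))"
    by (rule has_bochner_integral_even_function) auto
  then show ?thesis
    by (auto simp: has_bochner_integral_iff)
qed

text \<open>
  The ratio test for integrals over the line: geometric decay at both ends gives an exponentially
  decreasing majorant.
\<close>

lemma integrable_if_ratio_less_one:
  fixes g :: "real \<Rightarrow> real"
  assumes cont: "continuous_on UNIV g" and nonneg: "\<And>x. 0 \<le> g x"
    and right: "0 < \<rho>" "\<rho> < 1" "eventually (\<lambda>x. g (x + 1) \<le> \<rho> * g x) at_top"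
    and left: "0 < \<sigma>" "\<sigma> < 1" "eventually (\<lambda>x. g (- (x + 1)) \<le> \<sigma> * g (- x)) at_top"
  shows "integrable lborel g"
proof -
  obtain M N where M: "\<And>x. x \<ge> M \<Longrightarrow> g (x + 1) \<le> \<rho> * g x"
    and N: "\<And>x. x \<ge> N \<Longrightarrow> g (- (x + 1)) \<le> \<sigma> * g (- x)"
    using right(3) left(3) by (auto simp: eventually_at_top_linorder)
  obtain C where C: "C \<ge> 0" "\<And>x. x \<ge> M \<Longrightarrow> g x \<le> C * exp (ln \<rho> * x)"
    using geometric_decay_bound[OF cont nonneg right(1,2) M] by blast
  have "continuous_on UNIV (\<lambda>x. g (- x))"
    by (rule continuous_on_compose2[OF cont]) (auto intro!: continuous_intros)
  then obtain D where D: "D \<ge> 0" "\<And>x. x \<ge> N \<Longrightarrow> g (- x) \<le> D * exp (ln \<sigma> * x)"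
    using geometric_decay_bound[of "\<lambda>x. g (- x)", OF _ nonneg left(1,2) N] by blast
  have "\<exists>x\<in>{- \<bar>N\<bar>..\<bar>M\<bar>}. \<forall>y\<in>{- \<bar>N\<bar>..\<bar>M\<bar>}. g y \<le> g x"
    by (rule continuous_attains_sup) (use cont in \<open>auto intro: continuous_on_subset\<close>)
  then obtain x0 where x0: "\<And>y. - \<bar>N\<bar> \<le> y \<Longrightarrow> y \<le> \<bar>M\<bar> \<Longrightarrow> g y \<le> g x0"
    using atLeastAtMost_iff by blast
  let ?h = "\<lambda>x. C * exp (- (- ln \<rho>) * \<bar>x\<bar>) + D * exp (- (- ln \<sigma>) * \<bar>x\<bar>) + g x0 * indicator {- \<bar>N\<bar>..\<bar>M\<bar>} x"
  show ?thesis
  proof (rule Bochner_Integration.integrable_bound)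
    show "integrable lborel ?h"
    proof (intro Bochner_Integration.integrable_add integrable_mult_right integrable_exp_neg_abs)
      show "integrable lborel (indicator {- \<bar>N\<bar>..\<bar>M\<bar>} :: real \<Rightarrow> real)"
        by (rule integrable_real_indicator) auto
    qed (use right left in auto)
    show "g \<in> borel_measurable lborel"
      using borel_measurable_continuous_onI[OF cont] by simp
    have "g x \<le> ?h x" for x
    proof -
      consider "- \<bar>N\<bar> \<le> x \<and> x \<le> \<bar>M\<bar>" | "x > \<bar>M\<bar>" | "x < - \<bar>N\<bar>"
        by linarith
      then show ?thesis
      proof cases
        case 1
        then have "g x \<le> g x0 * indicator {- \<bar>N\<bar>..\<bar>M\<bar>} x"
          using x0 by simp
        then show ?thesis
          using C(1) D(1) by (simp add: add_increasing)
      next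
        case 2
        then have "g x \<le> C * exp (ln \<rho> * \<bar>x\<bar>)"
          using C(2)[of x] by simp
        then show ?thesis
          using D(1) nonneg[of x0] by (simp add: add_increasing2)
      next
        case 3
        then have "g x \<le> D * exp (ln \<sigma> * \<bar>x\<bar>)"
          using D(2)[of "- x"] by simp
        then show ?thesis
          using C(1) nonneg[of x0] by (simp add: add_increasing add_increasing2)
      qed
    qed
    then show "AE x in lborel. norm (g x) \<le> norm (?h x)"
      using nonneg by (intro AE_I2) (metis abs_of_nonneg order_trans real_norm_def)
  qed
qed

section \<open>A real majorant of the integrands\<close>

text \<open>
  With \<open>s = ln (norm z)\<close> (that is, \<open>A = ln (norm \<alpha>)\<close> and \<open>R = ln (norm q)\<close>) this bounds
  \<open>z\<^sup>k E \<Prod>\<^sub>t (-\<beta>' t z, \<gamma>' t/z; q)\<close> for all complex \<open>\<beta>'\<close>, \<open>\<gamma>'\<close> of modulus \<open>\<beta>\<close>, \<open>\<gamma>\<close> and all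
  parameters bounded by the \<open>t\<^sub>i\<close>. The integrand needs \<open>k = 1\<close> and \<open>k = -1\<close> with
  \<open>\<beta> = \<gamma> = norm q\<close>; the telescoping function needs \<open>k = 2\<close>, \<open>\<beta> = norm q\<close>, \<open>\<gamma> = 1\<close>.
\<close>

definition gauss_maj :: "real \<Rightarrow> real \<Rightarrow> real \<Rightarrow> real \<Rightarrow> real \<Rightarrow> real \<times> real \<times> real \<times> real \<Rightarrow> real \<Rightarrow> real" where
  "gauss_maj R A k \<beta> \<gamma> = (\<lambda>(t1, t2, t3, t4) x.
     let s = A + R * x; K = (\<lambda>t. qpoch_maj (exp R) (\<beta> * t * exp s) * qpoch_maj (exp R) (\<gamma> * t * exp (- s)))
     in exp (k * s + 2 * R * x\<^sup>2 + 4 * A * x) * (K t1 * K t2 * K t3 * K t4))"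

text \<open>
  Reflecting \<open>x\<close> exchanges the roles of \<open>z\<close> and \<open>1/z\<close>, so only the behaviour at \<open>+\<infinity>\<close> has to be
  studied.
\<close>

lemma gauss_maj_uminus:
  "gauss_maj R A k \<beta> \<gamma> T (- x) = gauss_maj R (- A) (- k) \<gamma> \<beta> T x"
  by (cases T) (simp add: gauss_maj_def Let_def algebra_simps)

lemma gauss_maj_nonneg: "0 \<le> gauss_maj R A k \<beta> \<gamma> T x"
  by (cases T) (simp add: gauss_maj_def Let_def qpoch_maj_nonneg)

lemma continuous_on_gauss_maj:
  "R < 0 \<Longrightarrow> continuous_on S (gauss_maj R A k \<beta> \<gamma> T)"
  by (cases T) (auto simp: gauss_maj_def Let_def intro!: continuous_intros)

text \<open>
  A unit step multiplies the Gaussian by \<open>exp (4 s)\<close> up to a constant. Each of the four pairs of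
  infinite products contributes a rational factor times \<open>exp (- s)\<close>, so that the exponentials
  cancel: the growth of the products balances the decay of the Gaussian, and only the bounded
  ratio \<open>w\<close> is left.
\<close>

lemma gauss_maj_shift:
  fixes R A k \<beta> \<gamma> t1 t2 t3 t4 x :: real
  defines "s \<equiv> A + R * x"
  defines "w \<equiv> \<lambda>t. (exp R * exp s + \<gamma> * t) / (1 + \<beta> * t * exp s)"
  assumes "R < 0" and "\<beta> \<ge> 0" "\<gamma> \<ge> 0" "t1 \<ge> 0" "t2 \<ge> 0" "t3 \<ge> 0" "t4 \<ge> 0"
  shows "gauss_maj R A k \<beta> \<gamma> (t1, t2, t3, t4) (x + 1) =
    (exp ((k - 2) * R) * (w t1 * w t2 * w t3 * w t4)) * gauss_maj R A k \<beta> \<gamma> (t1, t2, t3, t4) x"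
proof -
  define K where "K s t = qpoch_maj (exp R) (\<beta> * t * exp s) * qpoch_maj (exp R) (\<gamma> * t * exp (- s))" for s t
  have K: "K (s + R) t = exp (- s - R) * w t * K s t" if "t \<ge> 0" for t
  proof -
    have 1: "qpoch_maj (exp R) (\<beta> * t * exp s) = (1 + \<beta> * t * exp s) * qpoch_maj (exp R) (\<beta> * t * exp (s + R))"
      using qpoch_maj_rec[of "exp R" "\<beta> * t * exp s"] assms that by (simp add: exp_add mult_ac)
    have 2: "qpoch_maj (exp R) (\<gamma> * t * exp (- (s + R))) = (1 + \<gamma> * t * exp (- s - R)) * qpoch_maj (exp R) (\<gamma> * t * exp (- s))"
      using qpoch_maj_rec[of "exp R" "\<gamma> * t * exp (- s - R)"] assms that by (simp add: exp_add exp_diff mult_ac)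
    have 3: "1 + \<gamma> * t * exp (- s - R) = exp (- s - R) * (exp R * exp s + \<gamma> * t)"
      by (simp add: algebra_simps flip: exp_add)
    have "1 + \<beta> * t * exp s > 0"
      using assms that by (simp add: add_pos_nonneg)
    then show ?thesis
      unfolding K_def 1 2 3 w_def by (simp add: field_simps)
  qed
  have s': "A + R * (x + 1) = s + R"
    by (simp add: s_def algebra_simps)
  have e: "exp (k * (s + R) + 2 * R * (x + 1)\<^sup>2 + 4 * A * (x + 1)) * exp (- s - R) ^ 4
      = exp ((k - 2) * R) * exp (k * s + 2 * R * x\<^sup>2 + 4 * A * x)"
    unfolding exp_of_nat_mult[symmetric] exp_add[symmetric]
    by (simp add: s_def algebra_simps power2_eq_square flip: exp_of_nat_mult exp_add)
  have "gauss_maj R A k \<beta> \<gamma> (t1, t2, t3, t4) (x + 1) =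
      exp (k * (s + R) + 2 * R * (x + 1)\<^sup>2 + 4 * A * (x + 1)) * (K (s + R) t1 * K (s + R) t2 * K (s + R) t3 * K (s + R) t4)"
    by (simp only: gauss_maj_def Let_def prod.case s' K_def)
  also have "\<dots> = (exp (k * (s + R) + 2 * R * (x + 1)\<^sup>2 + 4 * A * (x + 1)) * exp (- s - R) ^ 4) *
      (w t1 * w t2 * w t3 * w t4) * (K s t1 * K s t2 * K s t3 * K s t4)"
    unfolding K[OF assms(6)] K[OF assms(7)] K[OF assms(8)] K[OF assms(9)] by (simp only: power4_eq_xxxx mult_ac)
  also have "\<dots> = (exp ((k - 2) * R) * (w t1 * w t2 * w t3 * w t4)) * gauss_maj R A k \<beta> \<gamma> (t1, t2, t3, t4) x"
    unfolding e by (simp add: gauss_maj_def Let_def K_def s_def mult_ac)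
  finally show ?thesis .
qed

text \<open>
  As \<open>x \<rightarrow> \<infinity>\<close>, \<open>exp s\<close> tends to \<open>0\<close> and each \<open>w t\<close> tends to \<open>\<gamma> t\<close>; the hypothesis \<open>small\<close> says
  that the limit ratio is less than \<open>1\<close>.
\<close>

lemma gauss_maj_eventually_decreasing:
  assumes "R < 0" and "\<beta> \<ge> 0" "\<gamma> \<ge> 0" "t1 \<ge> 0" "t2 \<ge> 0" "t3 \<ge> 0" "t4 \<ge> 0"
    and small: "exp ((k - 2) * R) * \<gamma> ^ 4 * (t1 * t2 * t3 * t4) < 1"
  shows "\<exists>\<rho>. 0 < \<rho> \<and> \<rho> < 1 \<and> eventually (\<lambda>x. gauss_maj R A k \<beta> \<gamma> (t1, t2, t3, t4) (x + 1)
      \<le> \<rho> * gauss_maj R A k \<beta> \<gamma> (t1, t2, t3, t4) x) at_top"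
proof -
  define w where "w x t = (exp R * exp (A + R * x) + \<gamma> * t) / (1 + \<beta> * t * exp (A + R * x))" for x t
  have exp0: "((\<lambda>x. exp (A + R * x)) \<longlongrightarrow> 0) at_top"
    using assms(1) by real_asymp
  have w: "((\<lambda>x. w x t) \<longlongrightarrow> (exp R * 0 + \<gamma> * t) / (1 + \<beta> * t * 0)) at_top" for t
    unfolding w_def by (intro tendsto_intros exp0) auto
  have "((\<lambda>x. exp ((k - 2) * R) * (w x t1 * w x t2 * w x t3 * w x t4)) \<longlongrightarrow>
      exp ((k - 2) * R) * ((exp R * 0 + \<gamma> * t1) / (1 + \<beta> * t1 * 0) * ((exp R * 0 + \<gamma> * t2) / (1 + \<beta> * t2 * 0)) *
       ((exp R * 0 + \<gamma> * t3) / (1 + \<beta> * t3 * 0)) * ((exp R * 0 + \<gamma> * t4) / (1 + \<beta> * t4 * 0)))) at_top"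
    by (intro tendsto_intros w)
  then have lim: "((\<lambda>x. exp ((k - 2) * R) * (w x t1 * w x t2 * w x t3 * w x t4)) \<longlongrightarrow>
      exp ((k - 2) * R) * \<gamma> ^ 4 * (t1 * t2 * t3 * t4)) at_top"
    by (simp add: power4_eq_xxxx mult_ac)
  \<comment> \<open>The limit ratio may be \<open>0\<close>, but the decay rate has to be positive.\<close>
  have "max (exp ((k - 2) * R) * \<gamma> ^ 4 * (t1 * t2 * t3 * t4)) 0 < 1"
    using small by simp
  then obtain \<rho> where \<rho>: "max (exp ((k - 2) * R) * \<gamma> ^ 4 * (t1 * t2 * t3 * t4)) 0 < \<rho>" "\<rho> < 1"
    using dense by blast
  have "eventually (\<lambda>x. exp ((k - 2) * R) * (w x t1 * w x t2 * w x t3 * w x t4) < \<rho>) at_top"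
    using order_tendstoD(2)[OF lim] \<rho> by auto
  then have "eventually (\<lambda>x. gauss_maj R A k \<beta> \<gamma> (t1, t2, t3, t4) (x + 1)
      \<le> \<rho> * gauss_maj R A k \<beta> \<gamma> (t1, t2, t3, t4) x) at_top"
  proof eventually_elim
    case (elim x)
    then show ?case
      unfolding gauss_maj_shift[OF assms(1-7)] w_def[symmetric]
      by (intro mult_right_mono gauss_maj_nonneg) auto
  qed
  then show ?thesis
    using \<rho> by auto
qed

lemma integrable_gauss_maj:
  assumes "R < 0" and "\<beta> \<ge> 0" "\<gamma> \<ge> 0" "t1 \<ge> 0" "t2 \<ge> 0" "t3 \<ge> 0" "t4 \<ge> 0"
    and "exp ((k - 2) * R) * \<gamma> ^ 4 * (t1 * t2 * t3 * t4) < 1"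
    and "exp ((- k - 2) * R) * \<beta> ^ 4 * (t1 * t2 * t3 * t4) < 1"
  shows "integrable lborel (gauss_maj R A k \<beta> \<gamma> (t1, t2, t3, t4))"
proof -
  obtain \<rho> where "0 < \<rho>" "\<rho> < 1" "eventually (\<lambda>x. gauss_maj R A k \<beta> \<gamma> (t1, t2, t3, t4) (x + 1)
      \<le> \<rho> * gauss_maj R A k \<beta> \<gamma> (t1, t2, t3, t4) x) at_top"
    using gauss_maj_eventually_decreasing[OF assms(1-8)] by blast
  moreover obtain \<sigma> where "0 < \<sigma>" "\<sigma> < 1"
    "eventually (\<lambda>x. gauss_maj R A k \<beta> \<gamma> (t1, t2, t3, t4) (- (x + 1))
      \<le> \<sigma> * gauss_maj R A k \<beta> \<gamma> (t1, t2, t3, t4) (- x)) at_top"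
    using gauss_maj_eventually_decreasing[OF assms(1,3,2,4-7,9)] unfolding gauss_maj_uminus by blast
  ultimately show ?thesis
    using gauss_maj_nonneg continuous_on_gauss_maj[OF assms(1)]
    by (intro integrable_if_ratio_less_one[where \<rho> = \<rho> and \<sigma> = \<sigma>]) auto
qed

section \<open>The contiguous relation\<close>

text \<open>
  The logarithms \<open>l\<close> of \<open>\<alpha>\<close> and \<open>lam\<close> of \<open>q\<close> are the primary data, because the powers of \<open>\<alpha>\<close> and
  \<open>q\<close> in the integrand are defined through them. The functions \<open>z\<close>, \<open>gauss\<close> and \<open>P t\<close> below are the
  \<open>z\<close>, \<open>E\<close> and \<open>P\<^sub>t\<close> of the introduction.
\<close>

locale askey_weight =
  fixes l lam :: complex
  assumes Re_lam: "Re lam < 0"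
begin

definition q :: complex where "q = exp lam"

definition z :: "real \<Rightarrow> complex" where "z x = exp (l + of_real x * lam)"

definition gauss :: "real \<Rightarrow> complex" where
  "gauss x = exp (2 * lam * of_real x ^ 2 + 4 * l * of_real x)"

definition P :: "complex \<Rightarrow> real \<Rightarrow> complex" where
  "P t x = qpoch_inf (- (q * t * z x)) q * qpoch_inf (q * t / z x) q"

definition f :: "complex \<Rightarrow> complex \<Rightarrow> complex \<Rightarrow> complex \<Rightarrow> real \<Rightarrow> complex" where
  "f a b c d x = (z x + 1 / z x) * gauss x * (P a x * P b x * P c x * P d x)"

text \<open>
  In contrast to \<open>P\<close> the two arguments carry different powers of \<open>q\<close>. This makes both \<open>Q t x\<close> and
  \<open>Q t (x - 1)\<close> linear factors times \<open>P t x\<close>.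
\<close>

definition Q :: "complex \<Rightarrow> real \<Rightarrow> complex" where
  "Q t x = qpoch_inf (- (q * t * z x)) q * qpoch_inf (t / z x) q"

definition \<psi> :: "complex \<Rightarrow> complex \<Rightarrow> complex \<Rightarrow> complex \<Rightarrow> real \<Rightarrow> complex" where
  "\<psi> a b c d x = z x ^ 2 * gauss x * (Q a x * Q b x * Q c x * Q d x)"

lemma norm_q: "norm q = exp (Re lam)"
  by (simp add: q_def)

lemma norm_q_less_1: "norm q < 1"
  using Re_lam by (simp add: q_def)

lemma q_nonzero [simp]: "q \<noteq> 0"
  by (simp add: q_def)

lemma z_nonzero [simp]: "z x \<noteq> 0"
  by (simp add: z_def)

lemma norm_z: "norm (z x) = exp (Re l + Re lam * x)"
  by (simp add: z_def mult.commute)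

lemma norm_one_over_z: "norm (1 / z x) = exp (- (Re l + Re lam * x))"
  unfolding norm_divide norm_z exp_minus by (simp only: norm_one divide_inverse mult_1_left)

lemma norm_gauss: "norm (gauss x) = exp (2 * Re lam * x\<^sup>2 + 4 * Re l * x)"
  by (simp add: gauss_def flip: of_real_power)

lemma continuous_z [continuous_intros]: "continuous_on S z"
  unfolding z_def by (intro continuous_intros)

lemma continuous_gauss [continuous_intros]: "continuous_on S gauss"
  unfolding gauss_def by (intro continuous_intros)

lemma continuous_P [continuous_intros]: "continuous_on S (P t)"
  unfolding P_def by (intro continuous_intros norm_q_less_1) auto

lemma continuous_Q [continuous_intros]: "continuous_on S (Q t)"
  unfolding Q_def by (intro continuous_intros norm_q_less_1) auto

lemma f_measurable: "f a b c d \<in> borel_measurable lborel"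
proof -
  have "continuous_on UNIV (f a b c d)"
    unfolding f_def by (intro continuous_intros) auto
  then show ?thesis
    using borel_measurable_continuous_onI by simp
qed

lemma \<psi>_measurable: "\<psi> a b c d \<in> borel_measurable lborel"
proof -
  have "continuous_on UNIV (\<psi> a b c d)"
    unfolding \<psi>_def by (intro continuous_intros)
  then show ?thesis
    using borel_measurable_continuous_onI by simp
qed

lemma norm_qpoch_pair_le:
  assumes "norm t \<le> \<tau>" "norm g = \<gamma>"
  shows "norm (qpoch_inf (- (q * t * z x)) q * qpoch_inf (g * t / z x) q) \<le>
    qpoch_maj (exp (Re lam)) (exp (Re lam) * \<tau> * exp (Re l + Re lam * x)) *
    qpoch_maj (exp (Re lam)) (\<gamma> * \<tau> * exp (- (Re l + Re lam * x)))"
proof -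
  have "norm (g * t / z x) = \<gamma> * norm t * exp (- (Re l + Re lam * x))"
    unfolding norm_mult norm_divide norm_z exp_minus assms(2) by (simp only: divide_inverse)
  also have "\<dots> \<le> \<gamma> * \<tau> * exp (- (Re l + Re lam * x))"
    using assms by (intro mult_right_mono mult_left_mono) auto
  finally have 1: "norm (g * t / z x) \<le> \<gamma> * \<tau> * exp (- (Re l + Re lam * x))" .
  have "norm (- (q * t * z x)) = norm q * norm t * exp (Re l + Re lam * x)"
    by (simp add: norm_mult norm_z)
  also have "\<dots> \<le> norm q * \<tau> * exp (Re l + Re lam * x)"
    using assms by (intro mult_right_mono mult_left_mono) auto
  finally have 2: "norm (- (q * t * z x)) \<le> norm q * \<tau> * exp (Re l + Re lam * x)" .
  show ?thesis
    unfolding norm_mult norm_q[symmetric]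
    by (intro mult_mono norm_qpoch_inf_le norm_q_less_1 qpoch_maj_nonneg norm_ge_zero 1 2)
qed

lemma mult4_mono:
  fixes p1 p2 p3 p4 :: real
  assumes "0 \<le> p1" "0 \<le> p2" "0 \<le> p3" "0 \<le> p4" "p1 \<le> r1" "p2 \<le> r2" "p3 \<le> r3" "p4 \<le> r4"
  shows "p1 * p2 * p3 * p4 \<le> r1 * r2 * r3 * r4"
  using assms by (intro mult_mono) (auto intro!: mult_nonneg_nonneg)

lemma norm_f_le:
  assumes "norm a \<le> t1" "norm b \<le> t2" "norm c \<le> t3" "norm d \<le> t4"
  shows "norm (f a b c d x) \<le>
    gauss_maj (Re lam) (Re l) 1 (norm q) (norm q) (t1, t2, t3, t4) x +
    gauss_maj (Re lam) (Re l) (- 1) (norm q) (norm q) (t1, t2, t3, t4) x"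
proof -
  let ?s = "Re l + Re lam * x" and ?g = "exp (2 * Re lam * x\<^sup>2 + 4 * Re l * x)"
  let ?K = "\<lambda>t. qpoch_maj (exp (Re lam)) (norm q * t * exp ?s) * qpoch_maj (exp (Re lam)) (norm q * t * exp (- ?s))"
  have K: "norm (P t x) \<le> ?K \<tau>" if "norm t \<le> \<tau>" for t \<tau>
    using norm_qpoch_pair_le[OF that refl, where g = q and x = x] by (simp add: P_def norm_q)
  have "norm (z x + 1 / z x) \<le> exp ?s + exp (- ?s)"
    using norm_triangle_ineq[of "z x" "1 / z x"] by (simp only: norm_z norm_one_over_z)
  then have "norm (f a b c d x) \<le> (exp ?s + exp (- ?s)) * ?g * (?K t1 * ?K t2 * ?K t3 * ?K t4)"
    unfolding f_def norm_mult norm_gauss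
    by (intro mult_right_mono mult_mono[of _ _ "norm (P a x) * norm (P b x) * norm (P c x) * norm (P d x)"]
         mult4_mono K assms mult_nonneg_nonneg norm_ge_zero add_nonneg_nonneg exp_ge_zero)
  also have "\<dots> = gauss_maj (Re lam) (Re l) 1 (norm q) (norm q) (t1, t2, t3, t4) x +
    gauss_maj (Re lam) (Re l) (- 1) (norm q) (norm q) (t1, t2, t3, t4) x"
    unfolding gauss_maj_def prod.case Let_def distrib_right[symmetric] exp_add[symmetric]
    by (simp add: algebra_simps exp_add[symmetric])
  finally show ?thesis .
qed

lemma norm_\<psi>_le:
  "norm (\<psi> a b c d x) \<le> gauss_maj (Re lam) (Re l) 2 (norm q) 1 (norm a, norm b, norm c, norm d) x"
proof -
  let ?s = "Re l + Re lam * x" and ?g = "exp (2 * Re lam * x\<^sup>2 + 4 * Re l * x)"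
  let ?K = "\<lambda>t. qpoch_maj (exp (Re lam)) (norm q * t * exp ?s) * qpoch_maj (exp (Re lam)) (1 * t * exp (- ?s))"
  have K: "norm (Q t x) \<le> ?K (norm t)" for t
    using norm_qpoch_pair_le[OF order.refl[of "norm t"], where g = 1 and \<gamma> = 1 and x = x] by (simp add: Q_def norm_q)
  have "norm (z x ^ 2) = exp (2 * ?s)"
    unfolding norm_power norm_z exp_double ..
  then have "norm (\<psi> a b c d x) \<le> exp (2 * ?s) * ?g * (?K (norm a) * ?K (norm b) * ?K (norm c) * ?K (norm d))"
    unfolding \<psi>_def norm_mult norm_gauss
    by (intro mult_mono[of _ _ "norm (Q a x) * norm (Q b x) * norm (Q c x) * norm (Q d x)"]
         mult4_mono K mult_nonneg_nonneg norm_ge_zero exp_ge_zero) auto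
  also have "\<dots> = gauss_maj (Re lam) (Re l) 2 (norm q) 1 (norm a, norm b, norm c, norm d) x"
    unfolding gauss_maj_def prod.case Let_def exp_add[symmetric]
    by (simp add: algebra_simps exp_add[symmetric])
  finally show ?thesis .
qed

text \<open>
  For \<open>k = \<plusminus>1\<close> the limit ratios at the two ends are \<open>|q|\<close> and \<open>|q|\<^sup>3\<close> times the product of the
  \<open>t\<^sub>i\<close>.
\<close>

lemma integrable_f_maj:
  assumes "0 \<le> t1" "0 \<le> t2" "0 \<le> t3" "0 \<le> t4" "norm q * (t1 * t2 * t3 * t4) < 1" "k \<in> {- 1, 1}"
  shows "integrable lborel (gauss_maj (Re lam) (Re l) k (norm q) (norm q) (t1, t2, t3, t4))"
proof (rule integrable_gauss_maj)
  have *: "exp (m * Re lam) * norm q ^ 4 * (t1 * t2 * t3 * t4) < 1" if "m \<in> {- 3, - 1}" for m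
  proof -
    have "exp (m * Re lam) * norm q ^ 4 = exp ((m + 4) * Re lam)"
      unfolding norm_q exp_of_nat_mult[symmetric] by (simp add: algebra_simps flip: exp_add)
    also have "\<dots> \<le> exp (Re lam)"
      using that Re_lam by auto
    finally have "exp (m * Re lam) * norm q ^ 4 * (t1 * t2 * t3 * t4) \<le> norm q * (t1 * t2 * t3 * t4)"
      unfolding norm_q using assms(1-4) by (intro mult_right_mono) auto
    then show ?thesis
      using assms(5) by simp
  qed
  show "exp ((k - 2) * Re lam) * norm q ^ 4 * (t1 * t2 * t3 * t4) < 1"
    by (rule *) (use assms(6) in auto)
  show "exp ((- k - 2) * Re lam) * norm q ^ 4 * (t1 * t2 * t3 * t4) < 1"
    by (rule *) (use assms(6) in auto)
qed (use assms Re_lam in auto)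

lemma integrable_f:
  assumes "norm (q * a * b * c * d) < 1"
  shows "integrable lborel (f a b c d)"
proof (rule Bochner_Integration.integrable_bound)
  let ?G = "\<lambda>k. gauss_maj (Re lam) (Re l) k (norm q) (norm q) (norm a, norm b, norm c, norm d)"
  show "integrable lborel (\<lambda>x. ?G 1 x + ?G (- 1) x)"
    using assms by (intro Bochner_Integration.integrable_add integrable_f_maj) (auto simp: norm_mult mult_ac)
  show "AE x in lborel. norm (f a b c d x) \<le> norm (?G 1 x + ?G (- 1) x)"
    by (intro AE_I2 order_trans[OF norm_f_le[OF order.refl order.refl order.refl order.refl]]) simp
qed (rule f_measurable)

text \<open>
  Here the limit ratio is \<open>|abcd|\<close> at both ends. In the functional equation \<open>\<psi>\<close> is taken at
  \<open>(qa, b, c, d)\<close>, so the condition becomes the one for the integrability of \<open>f a b c d\<close>.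
\<close>

lemma integrable_\<psi>:
  assumes "norm (a * b * c * d) < 1"
  shows "integrable lborel (\<psi> a b c d)"
proof (rule Bochner_Integration.integrable_bound)
  let ?G = "gauss_maj (Re lam) (Re l) 2 (norm q) 1 (norm a, norm b, norm c, norm d)"
  have "exp ((- 2 - 2) * Re lam) * norm q ^ 4 = 1"
    unfolding norm_q exp_of_nat_mult[symmetric] by (simp flip: exp_add)
  then show "integrable lborel ?G"
    using assms Re_lam by (intro integrable_gauss_maj) (auto simp: norm_mult mult_ac)
  show "AE x in lborel. norm (\<psi> a b c d x) \<le> norm (?G x)"
    by (intro AE_I2 order_trans[OF norm_\<psi>_le]) simp
qed (rule \<psi>_measurable)

lemma z_minus_1: "z (x - 1) = z x / q"
  by (simp add: z_def q_def algebra_simps flip: exp_diff)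

lemma gauss_minus_1: "gauss (x - 1) = gauss x * q ^ 2 / z x ^ 4"
  unfolding gauss_def q_def z_def exp_of_nat_mult[symmetric]
  by (simp add: algebra_simps power2_eq_square flip: exp_diff exp_add)

lemma Q_eq: "Q t x = (1 - t / z x) * P t x"
  using qpoch_inf_rec[OF norm_q_less_1, of "t / z x"] by (simp add: P_def Q_def)

lemma Q_minus_1: "Q t (x - 1) = (1 + t * z x) * P t x"
  using qpoch_inf_rec[OF norm_q_less_1, of "- (t * z x)"]
  by (simp add: P_def Q_def z_minus_1 mult_ac)

lemma P_eq: "P t x = (1 + q * t * z x) * (1 - q * t / z x) * P (q * t) x"
  using qpoch_inf_rec[OF norm_q_less_1, of "- (q * t * z x)"] qpoch_inf_rec[OF norm_q_less_1, of "q * t / z x"]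
  by (simp add: P_def mult_ac)

text \<open>
  The identity behind the functional equation. The last bracket is odd under \<open>z \<mapsto> -1/z\<close>, as is
  \<open>z + 1/z\<close>. It equals \<open>(z + 1/z) ((1 - e\<^sub>4) (z - 1/z) - (e\<^sub>1 + e\<^sub>3))\<close>, where the \<open>e\<^sub>i\<close> are the elementary
  symmetric polynomials in \<open>a, b, c, d\<close>, while \<open>(1 + az)(1 - a/z) = 1 - a\<^sup>2 + a (z - 1/z)\<close>.
  Eliminating \<open>z - 1/z\<close> leaves \<open>(1 - a\<^sup>2)(1 - e\<^sub>4) + a (e\<^sub>1 + e\<^sub>3) = (1 + ab)(1 + ac)(1 + ad)\<close>.
\<close>

lemma telescoping_polynomial:
  fixes z a b c d :: complex
  assumes "z \<noteq> 0"
  shows "(1 - a * b * c * d) * ((1 + a * z) * (1 - a / z) * (z + 1 / z)) =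
    (1 + a * b) * (1 + a * c) * (1 + a * d) * (z + 1 / z) +
    a * (z ^ 2 * ((1 - a / z) * (1 - b / z) * (1 - c / z) * (1 - d / z)) -
         (1 + a * z) * (1 + b * z) * (1 + c * z) * (1 + d * z) / z ^ 2)"
proof -
  define y where "y = 1 / z"
  have zy: "z * y = 1"
    using assms by (simp add: y_def)
  have "(1 - a * b * c * d) * ((1 + a * z) * (1 - a * y) * (z + y)) =
    (1 + a * b) * (1 + a * c) * (1 + a * d) * (z + y) +
    a * (z ^ 2 * ((1 - a * y) * (1 - b * y) * (1 - c * y) * (1 - d * y)) -
         (1 + a * z) * (1 + b * z) * (1 + c * z) * (1 + d * z) * y ^ 2)"
    using zy by algebra
  then show ?thesis
    by (simp add: y_def power_divide)
qed

lemma f_contiguous: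
  "(1 - q * a * b * c * d) * f a b c d x =
   (1 + q * a * b) * (1 + q * a * c) * (1 + q * a * d) * f (q * a) b c d x +
   q * a * (\<psi> (q * a) b c d x - \<psi> (q * a) b c d (x - 1))"
proof -
  define Z where "Z = z x"
  define a' where "a' = q * a"
  have Z: "Z \<noteq> 0"
    by (simp add: Z_def)
  define C where "C = gauss x * (P a' x * P b x * P c x * P d x)"
  have "\<psi> a' b c d x = Z ^ 2 * ((1 - a' / Z) * (1 - b / Z) * (1 - c / Z) * (1 - d / Z)) * C"
    by (simp add: \<psi>_def Q_eq C_def Z_def mult_ac)
  moreover have "\<psi> a' b c d (x - 1) = (1 + a' * Z) * (1 + b * Z) * (1 + c * Z) * (1 + d * Z) / Z ^ 2 * C"
  proof -
    have "(Z / q) ^ 2 * (gauss x * q ^ 2 / Z ^ 4) = gauss x / Z ^ 2"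
      using Z by (simp add: field_simps power4_eq_xxxx power2_eq_square)
    then show ?thesis
      unfolding \<psi>_def Q_minus_1 gauss_minus_1 z_minus_1 Z_def[symmetric]
      by (simp add: C_def mult_ac)
  qed
  moreover have "f a b c d x = (1 + a' * Z) * (1 - a' / Z) * (Z + 1 / Z) * C"
    unfolding f_def P_eq[of a x] by (simp add: C_def a'_def Z_def mult_ac)
  moreover have "f a' b c d x = (Z + 1 / Z) * C"
    by (simp add: f_def C_def Z_def mult_ac)
  ultimately show ?thesis
    using arg_cong[OF telescoping_polynomial[OF Z, of a' b c d], of "\<lambda>u. u * C"]
    unfolding a'_def by (simp only: ring_distribs mult.assoc)
qed

definition F :: "complex \<Rightarrow> complex \<Rightarrow> complex \<Rightarrow> complex \<Rightarrow> complex" where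
  "F a b c d = (\<integral>x. f a b c d x \<partial>lborel)"

text \<open>
  In the integral of \<open>f_contiguous\<close> the difference of \<open>\<psi>\<close> and its translate vanishes.
\<close>

lemma F_contiguous:
  assumes "norm (q * a * b * c * d) < 1"
  shows "(1 - q * a * b * c * d) * F a b c d =
    (1 + q * a * b) * (1 + q * a * c) * (1 + q * a * d) * F (q * a) b c d"
proof -
  have *: "norm (q * (q * a) * b * c * d) < 1"
  proof -
    have "norm (q * (q * a) * b * c * d) = norm q * norm (q * a * b * c * d)"
      by (simp add: norm_mult mult_ac)
    also have "\<dots> \<le> 1 * norm (q * a * b * c * d)"
      using norm_q_less_1 by (intro mult_right_mono) auto
    finally show ?thesis
      using assms by simp
  qed
  let ?\<psi> = "\<psi> (q * a) b c d"
  have int: "integrable lborel ?\<psi>"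
    using assms by (rule integrable_\<psi>)
  have int': "integrable lborel (\<lambda>x. ?\<psi> (x - 1))"
    using lborel_integrable_real_affine[OF int, of 1 "- 1"] by simp
  have shift: "(\<integral>x. ?\<psi> (x - 1) \<partial>lborel) = (\<integral>x. ?\<psi> x \<partial>lborel)"
    using lborel_integral_real_affine[of 1 ?\<psi> "- 1"] by simp
  have "(1 - q * a * b * c * d) * F a b c d = (\<integral>x. (1 - q * a * b * c * d) * f a b c d x \<partial>lborel)"
    by (simp add: F_def)
  also have "\<dots> = (\<integral>x. (1 + q * a * b) * (1 + q * a * c) * (1 + q * a * d) * f (q * a) b c d x +
      q * a * (?\<psi> x - ?\<psi> (x - 1)) \<partial>lborel)"
    by (simp only: f_contiguous)
  also have "\<dots> = (\<integral>x. (1 + q * a * b) * (1 + q * a * c) * (1 + q * a * d) * f (q * a) b c d x \<partial>lborel) +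
      (\<integral>x. q * a * (?\<psi> x - ?\<psi> (x - 1)) \<partial>lborel)"
    by (intro Bochner_Integration.integral_add integrable_mult_right Bochner_Integration.integrable_diff
         int int' integrable_f *)
  also have "(\<integral>x. q * a * (?\<psi> x - ?\<psi> (x - 1)) \<partial>lborel) = 0"
    using int int' shift by simp
  finally show ?thesis
    by (simp add: F_def)
qed

section \<open>Contracting the parameters to zero\<close>

lemma F_iterate:
  assumes "norm (q * a * b * c * d) < 1"
  shows "(\<Prod>j<n. 1 - q * a * b * c * d * q ^ j) * F a b c d =
    (\<Prod>j<n. 1 - (- (q * a * b)) * q ^ j) * (\<Prod>j<n. 1 - (- (q * a * c)) * q ^ j) *
    (\<Prod>j<n. 1 - (- (q * a * d)) * q ^ j) * F (q ^ n * a) b c d"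
proof (induction n)
  case (Suc n)
  have "norm (q * (q ^ n * a) * b * c * d) = norm q ^ n * norm (q * a * b * c * d)"
    by (simp add: norm_mult norm_power mult_ac)
  also have "\<dots> \<le> 1 * norm (q * a * b * c * d)"
    using norm_q_less_1 by (intro mult_right_mono power_le_one) auto
  finally have "norm (q * (q ^ n * a) * b * c * d) < 1"
    using assms by simp
  from F_contiguous[OF this]
  have *: "(1 - q * a * b * c * d * q ^ n) * F (q ^ n * a) b c d =
    (1 - (- (q * a * b)) * q ^ n) * (1 - (- (q * a * c)) * q ^ n) * (1 - (- (q * a * d)) * q ^ n) *
      F (q ^ Suc n * a) b c d"
    by (simp add: mult_ac)
  have "(\<Prod>j<Suc n. 1 - q * a * b * c * d * q ^ j) * F a b c d =
      (1 - q * a * b * c * d * q ^ n) * ((\<Prod>j<n. 1 - q * a * b * c * d * q ^ j) * F a b c d)"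
    by (simp only: prod.lessThan_Suc mult_ac)
  also have "\<dots> = (\<Prod>j<n. 1 - (- (q * a * b)) * q ^ j) * (\<Prod>j<n. 1 - (- (q * a * c)) * q ^ j) *
    (\<Prod>j<n. 1 - (- (q * a * d)) * q ^ j) * ((1 - q * a * b * c * d * q ^ n) * F (q ^ n * a) b c d)"
    unfolding Suc.IH by (simp only: mult_ac)
  finally show ?case
    unfolding * by (simp only: prod.lessThan_Suc mult_ac)
qed auto

text \<open>
  The majorant for \<open>a\<close> serves for all \<open>q\<^sup>n a\<close>, because it only uses an upper bound of the moduli
  of the parameters.
\<close>

lemma F_tendsto_zero:
  assumes "norm (q * a * b * c * d) < 1"
  shows "(\<lambda>n. F (q ^ n * a) b c d) \<longlonglongrightarrow> F 0 b c d"
  unfolding F_def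
proof (rule integral_dominated_convergence)
  let ?G = "\<lambda>k. gauss_maj (Re lam) (Re l) k (norm q) (norm q) (norm a, norm b, norm c, norm d)"
  show "integrable lborel (\<lambda>x. ?G 1 x + ?G (- 1) x)"
    using assms by (intro Bochner_Integration.integrable_add integrable_f_maj) (auto simp: norm_mult mult_ac)
  have "norm (q ^ n * a) \<le> norm a" for n
  proof -
    have "norm (q ^ n * a) \<le> 1 * norm a"
      unfolding norm_mult norm_power using norm_q_less_1 by (intro mult_right_mono power_le_one) auto
    then show ?thesis by simp
  qed
  then show "AE x in lborel. norm (f (q ^ n * a) b c d x) \<le> ?G 1 x + ?G (- 1) x" for n
    by (intro AE_I2 norm_f_le order.refl)
  have 0: "(\<lambda>n. q ^ n * a) \<longlonglongrightarrow> 0"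
    using norm_q_less_1 by (intro tendsto_mult_left_zero LIMSEQ_power_zero)
  have "(\<lambda>n. f (q ^ n * a) b c d x) \<longlonglongrightarrow> f 0 b c d x" for x
    unfolding f_def P_def by (intro tendsto_intros norm_q_less_1 0 z_nonzero)
  then show "AE x in lborel. (\<lambda>n. f (q ^ n * a) b c d x) \<longlonglongrightarrow> f 0 b c d x"
    by simp
qed (use f_measurable in auto)

lemma F_remove_parameter:
  assumes "norm (q * a * b * c * d) < 1"
  shows "qpoch_inf (q * a * b * c * d) q * F a b c d =
    qpoch_inf (- (q * a * b)) q * qpoch_inf (- (q * a * c)) q * qpoch_inf (- (q * a * d)) q * F 0 b c d"
proof (rule LIMSEQ_unique)
  show "(\<lambda>n. (\<Prod>j<n. 1 - q * a * b * c * d * q ^ j) * F a b c d) \<longlonglongrightarrow>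
      qpoch_inf (q * a * b * c * d) q * F a b c d"
    by (intro tendsto_intros qpoch_inf_LIMSEQ norm_q_less_1)
  show "(\<lambda>n. (\<Prod>j<n. 1 - q * a * b * c * d * q ^ j) * F a b c d) \<longlonglongrightarrow>
      qpoch_inf (- (q * a * b)) q * qpoch_inf (- (q * a * c)) q * qpoch_inf (- (q * a * d)) q * F 0 b c d"
    unfolding F_iterate[OF assms]
    by (intro tendsto_intros qpoch_inf_LIMSEQ norm_q_less_1 F_tendsto_zero assms)
qed

lemma F_commute: "F a b c d = F b a c d" "F a b c d = F a c b d" "F a b c d = F a b d c"
  by (simp_all add: F_def f_def mult_ac)

text \<open>
  Once one parameter is \<open>0\<close>, the denominator is \<open>(0; q) = 1\<close>, and symmetry moves the next
  parameter to the front.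
\<close>

lemma F_eq:
  assumes "norm (q * a * b * c * d) < 1"
  shows "qpoch_inf (q * a * b * c * d) q * F a b c d =
    qpochs_inf [- (q * a * b), - (q * a * c), - (q * a * d), - (q * b * c), - (q * b * d), - (q * c * d)] q * F 0 0 0 0"
proof -
  have b: "F 0 b c d = qpoch_inf (- (q * b * c)) q * qpoch_inf (- (q * b * d)) q * F 0 0 c d"
    using F_remove_parameter[of b 0 c d] F_commute(1)[of b 0 c d] by simp
  have c: "F 0 0 c d = qpoch_inf (- (q * c * d)) q * F 0 0 0 d"
    using F_remove_parameter[of c 0 0 d] F_commute(1)[of c 0 0 d] F_commute(2)[of 0 0 c d] by simp
  have d: "F 0 0 0 d = F 0 0 0 0"
    using F_remove_parameter[of d 0 0 0] F_commute(1)[of d 0 0 0] F_commute(2)[of 0 0 d 0] F_commute(3)[of 0 0 0 d]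
    by simp
  show ?thesis
    unfolding F_remove_parameter[OF assms] b c d by (simp add: qpochs_inf_def mult_ac)
qed

end

section \<open>The complex Gaussian integral\<close>

text \<open>
  Cauchy's inequality turns the local domination of \<open>g\<close> into a Lipschitz bound for \<open>g\<close> in the
  parameter, which dominates the difference quotients. So domination of \<open>g\<close> alone suffices for
  differentiation under the integral sign.
\<close>

lemma holomorphic_on_parameter_integral:
  fixes g :: "complex \<Rightarrow> 'a \<Rightarrow> complex"
  assumes S: "open S"
    and meas: "\<And>p. p \<in> S \<Longrightarrow> g p \<in> borel_measurable M"
    and hol: "\<And>x. x \<in> space M \<Longrightarrow> (\<lambda>p. g p x) holomorphic_on S"
    and dom: "\<And>p. p \<in> S \<Longrightarrow> \<exists>r>0. \<exists>h. cball p r \<subseteq> S \<and> integrable M h \<and>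
                (\<forall>p'\<in>cball p r. \<forall>x\<in>space M. norm (g p' x) \<le> h x)"
  shows "(\<lambda>p. \<integral>x. g p x \<partial>M) holomorphic_on S"
  unfolding holomorphic_on_open[OF S]
proof
  fix p assume "p \<in> S"
  from dom[OF this] obtain r h where r: "r > 0" "cball p r \<subseteq> S" and h: "integrable M h"
    and le: "\<And>p' x. p' \<in> cball p r \<Longrightarrow> x \<in> space M \<Longrightarrow> norm (g p' x) \<le> h x"
    by blast
  have int: "integrable M (g p')" if "p' \<in> cball p r" for p'
    using that r(2) le by (intro Bochner_Integration.integrable_bound[OF h] meas AE_I2) (auto intro: order_trans[OF _ abs_ge_self])
  define D where "D x = deriv (\<lambda>p. g p x) p" for x
  have D: "((\<lambda>p. g p x) has_field_derivative D x) (at p)" if "x \<in> space M" for x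
    unfolding D_def using holomorphic_derivI[OF hol[OF that] S \<open>p \<in> S\<close>] .
  have lip: "norm (g p' x - g p x) \<le> 2 * h x / r * norm (p' - p)" if "x \<in> space M" "p' \<in> cball p (r / 2)" for p' x
  proof (rule field_differentiable_bound[where f' = "deriv (\<lambda>p. g p x)" and S = "cball p (r / 2)"])
    fix w assume w: "w \<in> cball p (r / 2)"
    have sub: "cball w (r / 2) \<subseteq> cball p r"
    proof
      fix v assume "v \<in> cball w (r / 2)"
      then show "v \<in> cball p r"
        using w dist_triangle[of p v w] by simp
    qed
    then have sub': "cball w (r / 2) \<subseteq> S"
      using r(2) by blast
    have "w \<in> S"
      using subsetD[OF sub', of w] r(1) by simp
    then show "((\<lambda>p. g p x) has_field_derivative deriv (\<lambda>p. g p x) w) (at w within cball p (r / 2))"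
      by (rule has_field_derivative_at_within[OF holomorphic_derivI[OF hol[OF that(1)] S]])
    have "norm ((deriv ^^ 1) (\<lambda>p. g p x) w) \<le> fact 1 * h x / (r / 2) ^ 1"
    proof (rule Cauchy_inequality)
      show "(\<lambda>p. g p x) holomorphic_on ball w (r / 2)"
        using hol[OF that(1)] sub' ball_subset_cball by (blast intro: holomorphic_on_subset)
      show "continuous_on (cball w (r / 2)) (\<lambda>p. g p x)"
        using hol[OF that(1)] sub' holomorphic_on_imp_continuous_on continuous_on_subset by blast
      show "norm (g v x) \<le> h x" if v: "norm (w - v) = r / 2" for v
        using v sub that by (intro le \<open>x \<in> space M\<close>) (auto simp: dist_norm subset_iff)
    qed (use r in auto)
    then show "norm (deriv (\<lambda>p. g p x) w) \<le> 2 * h x / r"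
      by (simp add: mult.commute)
  qed (use that r in auto)
  have "((\<lambda>p. \<integral>x. g p x \<partial>M) has_field_derivative (\<integral>x. D x \<partial>M)) (at p)"
    unfolding has_field_derivative_iff tendsto_at_iff_sequentially
  proof (intro allI impI)
    fix u :: "nat \<Rightarrow> complex"
    assume u: "\<forall>i. u i \<in> UNIV - {p}" "u \<longlonglongrightarrow> p"
    then have "eventually (\<lambda>n. dist (u n) p < r / 2) sequentially"
      using r(1) by (intro tendstoD) auto
    then obtain N where N: "\<And>n. n \<ge> N \<Longrightarrow> dist (u n) p < r / 2"
      by (auto simp: eventually_sequentially)
    \<comment> \<open>The bounds hold only near \<open>p\<close>, so the first terms of the sequence are dropped.\<close>
    define v where "v n = u (n + N)" for n
    have v: "v n \<noteq> p" "v n \<in> cball p (r / 2)" "v n \<in> cball p r" for n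
      using u(1) N[of "n + N"] r(1) by (auto simp: v_def dist_commute)
    have vlim: "v \<longlonglongrightarrow> p"
      unfolding v_def using u(2) by (rule LIMSEQ_ignore_initial_segment)
    have p: "p \<in> cball p r"
      using r by simp
    have lim: "(\<lambda>n. (g (v n) x - g p x) / (v n - p)) \<longlonglongrightarrow> D x" if "x \<in> space M" for x
      using D[OF that] vlim v(1) unfolding has_field_derivative_iff tendsto_at_iff_sequentially
      by (auto simp: comp_def)
    have meas': "(\<lambda>x. (g (v n) x - g p x) / (v n - p)) \<in> borel_measurable M" for n
      using v(3)[of n] r(2) \<open>p \<in> S\<close> by (intro borel_measurable_divide borel_measurable_diff meas) auto
    have "(\<lambda>n. \<integral>x. (g (v n) x - g p x) / (v n - p) \<partial>M) \<longlonglongrightarrow> (\<integral>x. D x \<partial>M)"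
    proof (rule integral_dominated_convergence)
      show "D \<in> borel_measurable M"
        using meas' lim by (rule borel_measurable_LIMSEQ_metric)
      show "integrable M (\<lambda>x. 2 * h x / r)"
        using h by simp
      show "AE x in M. (\<lambda>n. (g (v n) x - g p x) / (v n - p)) \<longlonglongrightarrow> D x"
        using lim by (intro AE_I2) auto
      show "AE x in M. norm ((g (v n) x - g p x) / (v n - p)) \<le> 2 * h x / r" for n
        using lip[OF _ v(2)[of n]] v(1)[of n] by (intro AE_I2) (simp add: norm_divide pos_divide_le_eq)
    qed (rule meas')
    also have "(\<lambda>n. \<integral>x. (g (v n) x - g p x) / (v n - p) \<partial>M) =
        (\<lambda>n. ((\<integral>x. g (v n) x \<partial>M) - (\<integral>x. g p x \<partial>M)) / (v n - p))"
      using int[OF v(3)] int[OF p] by (simp add: fun_eq_iff)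
    finally show "((\<lambda>y. ((\<integral>x. g y x \<partial>M) - (\<integral>x. g p x \<partial>M)) / (y - p)) \<circ> u) \<longlonglongrightarrow> (\<integral>x. D x \<partial>M)"
      unfolding v_def by (subst LIMSEQ_offset[where k = N]) (simp_all add: comp_def LIMSEQ_offset)
  qed
  then show "\<exists>f'. ((\<lambda>p. \<integral>x. g p x \<partial>M) has_field_derivative f') (at p)"
    by blast
qed

lemma gaussian_integral_real:
  fixes c :: real
  assumes "c > 0"
  shows "has_bochner_integral lborel (\<lambda>x::real. exp (- c * x\<^sup>2)) (sqrt pi / sqrt c)"
proof -
  have "has_bochner_integral lborel (\<lambda>x::real. exp (- x\<^sup>2)) (2 *\<^sub>R (sqrt pi / 2))"
    by (rule has_bochner_integral_even_function[OF gaussian_moment_0]) auto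
  then have "has_bochner_integral lborel (\<lambda>x::real. exp (- (0 + sqrt c * x)\<^sup>2)) ((2 *\<^sub>R (sqrt pi / 2)) /\<^sub>R \<bar>sqrt c\<bar>)"
    using assms by (subst lborel_has_bochner_integral_real_affine_iff[symmetric]) auto
  moreover have "(2 *\<^sub>R (sqrt pi / 2)) /\<^sub>R \<bar>sqrt c\<bar> = sqrt pi / sqrt c"
    using assms by (simp add: field_simps)
  ultimately show ?thesis
    using assms by (simp add: power_mult_distrib)
qed

text \<open>
  The absolute value makes this usable as a majorant that is uniform in the direction of the
  complex shift.
\<close>

lemma integrable_exp_quadratic_real:
  fixes c m :: real
  assumes "c > 0"
  shows "integrable lborel (\<lambda>x::real. exp (- c * x\<^sup>2 + m * \<bar>x\<bar>))"
proof -
  have *: "integrable lborel (\<lambda>x::real. exp (- c * x\<^sup>2 + k * x))" for k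
  proof -
    have "integrable lborel (\<lambda>x::real. exp (k\<^sup>2 / (4 * c)) * exp (- c * (- (k / (2 * c)) + 1 * x)\<^sup>2))"
      using gaussian_integral_real[OF assms]
      by (intro integrable_mult_right lborel_integrable_real_affine[of "\<lambda>x. exp (- c * x\<^sup>2)"])
         (auto simp: has_bochner_integral_iff)
    also have "(\<lambda>x::real. exp (k\<^sup>2 / (4 * c)) * exp (- c * (- (k / (2 * c)) + 1 * x)\<^sup>2)) = (\<lambda>x. exp (- c * x\<^sup>2 + k * x))"
      unfolding exp_add[symmetric] using assms
      by (intro ext arg_cong[of _ _ exp]) (simp add: field_simps power2_eq_square)
    finally show ?thesis .
  qed
  show ?thesis
  proof (rule Bochner_Integration.integrable_bound)
    show "integrable lborel (\<lambda>x::real. exp (- c * x\<^sup>2 + m * x) + exp (- c * x\<^sup>2 + (- m) * x))"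
      by (intro Bochner_Integration.integrable_add *)
    have "exp (- c * x\<^sup>2 + m * \<bar>x\<bar>) \<le> exp (- c * x\<^sup>2 + m * x) + exp (- c * x\<^sup>2 + (- m) * x)" for x
      by (cases "x \<ge> 0") auto
    then show "AE x in lborel. norm (exp (- c * x\<^sup>2 + m * \<bar>x\<bar>)) \<le>
        norm (exp (- c * x\<^sup>2 + m * x) + exp (- c * x\<^sup>2 + (- m) * x))"
      by (intro AE_I2) simp
  qed simp
qed

text \<open>
  The majorant depends only on bounds for \<open>c\<close> and \<open>s\<close>, so it dominates the Gaussian locally uniformly
  in either of them.
\<close>

lemma norm_gaussian_le:
  fixes c s :: complex
  assumes "\<gamma> \<le> Re c" "norm c \<le> A" "norm s \<le> B"
  shows "norm (exp (- c * (of_real x + s)\<^sup>2)) \<le> exp (A * B\<^sup>2) * exp (- \<gamma> * x\<^sup>2 + (2 * A * B) * \<bar>x\<bar>)"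
proof -
  have A: "A \<ge> 0" and B: "B \<ge> 0"
    using assms norm_ge_zero order_trans by blast+
  have "- c * (of_real x + s)\<^sup>2 = - (c * of_real (x\<^sup>2)) + (- (2 * c * s) * of_real x - c * s\<^sup>2)"
    by (simp add: power2_eq_square algebra_simps)
  then have "Re (- c * (of_real x + s)\<^sup>2) = - (Re c * x\<^sup>2) + Re (- (2 * c * s) * of_real x - c * s\<^sup>2)"
    by simp
  also have "Re (- (2 * c * s) * of_real x - c * s\<^sup>2) \<le> norm (- (2 * c * s) * of_real x - c * s\<^sup>2)"
    by (rule complex_Re_le_cmod)
  also have "\<dots> \<le> norm (- (2 * c * s) * of_real x) + norm (c * s\<^sup>2)"
    by (rule norm_triangle_ineq4)
  also have "\<dots> = 2 * (norm c * norm s) * \<bar>x\<bar> + norm c * (norm s)\<^sup>2"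
    by (simp add: norm_mult norm_power)
  also have "\<dots> \<le> 2 * (A * B) * \<bar>x\<bar> + A * B\<^sup>2"
    using assms A B by (intro add_mono mult_right_mono mult_left_mono mult_mono power_mono) auto
  also have "- (Re c * x\<^sup>2) \<le> - (\<gamma> * x\<^sup>2)"
    using assms(1) by (simp add: mult_right_mono)
  finally show ?thesis
    by (simp add: exp_add[symmetric] algebra_simps)
qed

lemma gaussian_measurable: "(\<lambda>x. exp (- c * (of_real x + s)\<^sup>2)) \<in> borel_measurable (lborel :: real measure)" for c s :: complex
proof -
  have "continuous_on UNIV (\<lambda>x. exp (- c * (of_real x + s)\<^sup>2))"
    by (intro continuous_intros)
  then show ?thesis
    using borel_measurable_continuous_onI by simp
qed

lemma integrable_gaussian:
  fixes c s :: complex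
  assumes "Re c > 0"
  shows "integrable lborel (\<lambda>x. exp (- c * (of_real x + s)\<^sup>2))"
proof (rule Bochner_Integration.integrable_bound[OF _ gaussian_measurable])
  show "integrable lborel (\<lambda>x. exp (norm c * (norm s)\<^sup>2) * exp (- Re c * x\<^sup>2 + (2 * norm c * norm s) * \<bar>x\<bar>))"
    using assms by (intro integrable_mult_right integrable_exp_quadratic_real)
  show "AE x in lborel. norm (exp (- c * (of_real x + s)\<^sup>2)) \<le>
      norm (exp (norm c * (norm s)\<^sup>2) * exp (- Re c * x\<^sup>2 + (2 * norm c * norm s) * \<bar>x\<bar>))"
    using norm_gaussian_le[OF order.refl order.refl order.refl] by (intro AE_I2) simp
qed

text \<open>
  The integral is an entire function of \<open>s\<close>, and for real \<open>s\<close> it is constant by translation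
  invariance.
\<close>

lemma gaussian_integral_shift:
  fixes c s :: complex
  assumes "Re c > 0"
  shows "(\<integral>x. exp (- c * (of_real x + s)\<^sup>2) \<partial>lborel) = (\<integral>x. exp (- c * (of_real x)\<^sup>2) \<partial>lborel)"
proof -
  let ?I = "\<lambda>s. \<integral>x. exp (- c * (of_real x + s)\<^sup>2) \<partial>lborel"
  have "?I holomorphic_on UNIV"
  proof (rule holomorphic_on_parameter_integral[OF open_UNIV gaussian_measurable])
    fix p :: complex
    have "norm p' \<le> norm p + 1" if "p' \<in> cball p 1" for p'
      using that norm_triangle_sub[of p' p] by (simp add: dist_norm norm_minus_commute)
    then show "\<exists>r>0. \<exists>h. cball p r \<subseteq> UNIV \<and> integrable lborel h \<and>
        (\<forall>p'\<in>cball p r. \<forall>x\<in>space lborel. norm (exp (- c * (of_real x + p')\<^sup>2)) \<le> h x)"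
      using assms
      by (intro exI[of _ 1] conjI exI[of _ "\<lambda>x. exp (norm c * (norm p + 1)\<^sup>2) *
            exp (- Re c * x\<^sup>2 + (2 * norm c * (norm p + 1)) * \<bar>x\<bar>)"] ballI norm_gaussian_le
            integrable_mult_right integrable_exp_quadratic_real) auto
  qed (intro holomorphic_intros)
  then have "(\<lambda>s. ?I s - ?I 0) holomorphic_on UNIV"
    by (intro holomorphic_intros)
  moreover have "?I s - ?I 0 = 0" if s: "s \<in> \<real>" for s
  proof -
    obtain t where t: "s = of_real t"
      using s unfolding Reals_def by blast
    show ?thesis
      using lborel_integral_real_affine[of 1 "\<lambda>x. exp (- c * (of_real x)\<^sup>2)" t]
      by (simp add: t add.commute)
  qed
  moreover have "0 islimpt (\<real> :: complex set)"
  proof (rule islimptI)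
    fix T :: "complex set" assume "0 \<in> T" "open T"
    then obtain e where e: "e > 0" "ball 0 e \<subseteq> T"
      using open_contains_ball by blast
    then have "of_real (e / 2) \<in> T"
      by (intro subsetD[OF e(2)]) (simp add: norm_divide)
    then show "\<exists>y\<in>\<real>. y \<in> T \<and> y \<noteq> 0"
      using e(1) by (intro bexI[of _ "of_real (e / 2)"]) auto
  qed
  ultimately have "?I s - ?I 0 = 0"
    using analytic_continuation[of "\<lambda>s. ?I s - ?I 0" UNIV \<real> 0 s] by auto
  then show ?thesis
    by simp
qed

text \<open>
  Both sides are holomorphic in \<open>c\<close> on the right half plane and agree for \<open>c > 0\<close>. The principal
  square root is the right branch because it is holomorphic there and positive on the positive axis.
\<close>

lemma gaussian_integral_complex:
  fixes c s :: complex
  assumes "Re c > 0"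
  shows "(\<integral>x. exp (- c * (of_real x + s)\<^sup>2) \<partial>lborel) = of_real (sqrt pi) / csqrt c"
proof -
  let ?H = "{c. Re c > 0}"
  let ?I = "\<lambda>c. \<integral>x. exp (- c * (of_real x + (0 :: complex))\<^sup>2) \<partial>lborel"
  have open_H: "open ?H" and convex_H: "convex ?H"
    using open_halfspace_Re_gt convex_halfspace_Re_gt by auto
  have "?I holomorphic_on ?H"
  proof (rule holomorphic_on_parameter_integral[OF open_H gaussian_measurable])
    fix p :: complex assume "p \<in> ?H"
    define r where "r = Re p / 2"
    have r: "r > 0"
      using \<open>p \<in> ?H\<close> by (simp add: r_def)
    have bd: "r \<le> Re p'" "norm p' \<le> norm p + r" if "p' \<in> cball p r" for p'
    proof -
      have "norm (p' - p) \<le> r"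
        using that by (simp add: dist_norm norm_minus_commute)
      then show "norm p' \<le> norm p + r"
        using norm_triangle_sub[of p' p] by linarith
      have "\<bar>Re (p' - p)\<bar> \<le> r"
        using abs_Re_le_cmod[of "p' - p"] \<open>norm (p' - p) \<le> r\<close> by linarith
      then show "r \<le> Re p'"
        using r_def unfolding minus_complex.simps by linarith
    qed
    show "\<exists>r>0. \<exists>h. cball p r \<subseteq> ?H \<and> integrable lborel h \<and>
        (\<forall>p'\<in>cball p r. \<forall>x\<in>space lborel. norm (exp (- p' * (of_real x + 0)\<^sup>2)) \<le> h x)"
    proof (intro exI[of _ r] exI[of _ "\<lambda>x. exp ((norm p + r) * (0::real)\<^sup>2) *
            exp (- r * x\<^sup>2 + (2 * (norm p + r) * 0) * \<bar>x\<bar>)"] conjI ballI norm_gaussian_le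
            integrable_mult_right integrable_exp_quadratic_real)
      show "cball p r \<subseteq> ?H"
        using bd(1) r by force
    qed (use bd r in auto)
  qed (intro holomorphic_intros)
  moreover have "(\<lambda>c. of_real (sqrt pi) / csqrt c) holomorphic_on ?H"
    by (intro holomorphic_intros) (auto simp: complex_nonpos_Reals_iff)
  ultimately have "(\<lambda>c. ?I c - of_real (sqrt pi) / csqrt c) holomorphic_on ?H"
    by (rule holomorphic_on_diff)
  moreover have "?I c - of_real (sqrt pi) / csqrt c = 0" if c: "c \<in> of_real ` {0<..}" for c
  proof -
    obtain t where t: "c = of_real t" "t > 0"
      using c by auto
    have "?I c = (\<integral>x. of_real (exp (- t * x\<^sup>2)) \<partial>lborel)"
      by (simp add: t(1) flip: exp_of_real)
    also have "\<dots> = of_real (\<integral>x. exp (- t * x\<^sup>2) \<partial>lborel)"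
      by (rule integral_complex_of_real)
    also have "(\<integral>x. exp (- t * x\<^sup>2) \<partial>lborel) = sqrt pi / sqrt t"
      using gaussian_integral_real[OF t(2)] by (simp add: has_bochner_integral_iff)
    finally show ?thesis
      using t by (simp add: csqrt_of_real_nonneg)
  qed
  moreover have "1 islimpt ((of_real :: real \<Rightarrow> complex) ` {0<..})"
  proof (rule islimptI)
    fix T :: "complex set" assume "1 \<in> T" "open T"
    then obtain e where e: "e > 0" "ball 1 e \<subseteq> T"
      using open_contains_ball by blast
    have "of_real (1 + e / 2) \<in> T"
      using e(1) by (intro subsetD[OF e(2)]) (simp add: dist_norm norm_divide)
    then show "\<exists>y\<in>of_real ` {0<..}. y \<in> T \<and> y \<noteq> 1"
      using e(1) by (intro bexI[of _ "of_real (1 + e / 2)"] conjI) (auto simp del: of_real_add)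
  qed
  ultimately have "?I c - of_real (sqrt pi) / csqrt c = 0"
    using assms open_H convex_connected[OF convex_H]
    by (intro analytic_continuation[of "\<lambda>c. ?I c - of_real (sqrt pi) / csqrt c" ?H "of_real ` {0<..}" 1 c]) auto
  then show ?thesis
    using gaussian_integral_shift[OF assms, of s] by simp
qed

section \<open>Evaluation of the integral\<close>

lemma csqrt_2_mult:
  assumes "Re w > 0"
  shows "csqrt (2 * w) = of_real (sqrt 2) * csqrt w"
proof (rule csqrt_unique)
  have "(of_real (sqrt 2) :: complex)\<^sup>2 = 2"
    by (simp flip: of_real_power)
  then show "(of_real (sqrt 2) * csqrt w)\<^sup>2 = 2 * w"
    by (simp add: power_mult_distrib)
  have "w \<notin> \<real>\<^sub>\<le>\<^sub>0"
    using assms by (auto simp: complex_nonpos_Reals_iff)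
  then show "0 < Re (of_real (sqrt 2) * csqrt w) \<or>
      Re (of_real (sqrt 2) * csqrt w) = 0 \<and> 0 \<le> Im (of_real (sqrt 2) * csqrt w)"
    using csqrt_principal[of w] assms by auto
qed

context askey_weight
begin

text \<open>
  Completing the square in the two summands \<open>z E\<close> and \<open>E/z\<close> gives the centres
  \<open>l/lam \<plusminus> 1/4\<close>. The constant in front is the same for both, since the terms linear in \<open>l\<close> cancel.
\<close>

lemma F_0000: "F 0 0 0 0 = of_real (sqrt (2 * pi)) * exp (- 2 * l\<^sup>2 / lam - lam / 8) / csqrt (- lam)"
proof -
  have lam: "lam \<noteq> 0" and Re: "Re (- (2 * lam)) > 0"
    using Re_lam by auto
  let ?C = "exp (- 2 * l\<^sup>2 / lam - lam / 8)"
  let ?g = "\<lambda>s x. exp (- (- (2 * lam)) * (of_real x + s)\<^sup>2)"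
  have 1: "z x * gauss x = ?C * ?g (l / lam + 1 / 4) x" for x
    unfolding z_def gauss_def exp_add[symmetric]
    by (rule arg_cong[of _ _ exp]) (use lam in \<open>simp add: field_simps power2_eq_square\<close>)
  have 2: "1 / z x * gauss x = ?C * ?g (l / lam - 1 / 4) x" for x
    unfolding z_def gauss_def exp_add[symmetric] exp_diff[symmetric] inverse_eq_divide[symmetric] exp_minus[symmetric]
    by (rule arg_cong[of _ _ exp]) (use lam in \<open>simp add: field_simps power2_eq_square\<close>)
  have "f 0 0 0 0 = (\<lambda>x. ?C * ?g (l / lam + 1 / 4) x + ?C * ?g (l / lam - 1 / 4) x)"
    unfolding f_def distrib_right 1 2 by (simp add: P_def)
  then have "F 0 0 0 0 = (\<integral>x. ?C * ?g (l / lam + 1 / 4) x + ?C * ?g (l / lam - 1 / 4) x \<partial>lborel)"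
    by (simp add: F_def)
  also have "\<dots> = (\<integral>x. ?C * ?g (l / lam + 1 / 4) x \<partial>lborel) + (\<integral>x. ?C * ?g (l / lam - 1 / 4) x \<partial>lborel)"
    by (intro Bochner_Integration.integral_add integrable_mult_right integrable_gaussian Re)
  also have "\<dots> = ?C * (of_real (sqrt pi) / csqrt (- (2 * lam))) + ?C * (of_real (sqrt pi) / csqrt (- (2 * lam)))"
    unfolding integral_mult_right_zero gaussian_integral_complex[OF Re] ..
  also have "csqrt (- (2 * lam)) = of_real (sqrt 2) * csqrt (- lam)"
    using csqrt_2_mult[of "- lam"] Re_lam by simp
  also have "?C * (of_real (sqrt pi) / (of_real (sqrt 2) * csqrt (- lam))) + ?C * (of_real (sqrt pi) / (of_real (sqrt 2) * csqrt (- lam)))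
      = of_real (2 / sqrt 2 * sqrt pi) * ?C / csqrt (- lam)"
    by (simp add: field_simps)
  also have "2 / sqrt 2 * sqrt pi = sqrt (2 * pi)"
    by (simp add: real_sqrt_mult real_div_sqrt)
  finally show ?thesis .
qed

end

theorem theorem4p5:
  fixes q \<alpha> a b c d :: complex
  assumes "0 < norm q" and "norm q < 1"
    and "\<alpha> \<noteq> 0" and "a \<noteq> 0" and "b \<noteq> 0" and "c \<noteq> 0" and "d \<noteq> 0"
    and "norm (a * b * c * d) < inverse (norm q)"
  shows "integrable lborel (integrand q \<alpha> a b c d) \<and>
    (\<integral>x. integrand q \<alpha> a b c d x \<partial>lborel) =
      of_real (sqrt (2 * pi)) * \<alpha> * exp (2 * (Ln \<alpha>)\<^sup>2 / log_inv q) *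
      qpochs_inf [- (q * a * b), - (q * a * c), - (q * a * d),
                  - (q * b * c), - (q * b * d), - (q * c * d)] q /
      (q powr (1 / 8) * csqrt (log_inv q) * qpoch_inf (q * a * b * c * d) q)"
proof -
  have q0: "q \<noteq> 0"
    using assms(1) by auto
  interpret W: askey_weight "Ln \<alpha>" "Ln q"
    by unfold_locales (use assms(1,2) q0 in simp)
  have Wq: "W.q = q"
    using q0 by (simp add: W.q_def)
  have small: "norm (q * a * b * c * d) < 1"
  proof -
    have "norm (q * a * b * c * d) = norm q * norm (a * b * c * d)"
      by (simp add: norm_mult mult_ac)
    also have "\<dots> < norm q * inverse (norm q)"
      using assms by (intro mult_strict_left_mono)
    finally show ?thesis
      using assms(1) by simp
  qed
  have powr_q: "q powr y = exp (y * Ln q)" for y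
    using q0 by (simp add: powr_def)
  \<comment> \<open>Here \<open>1 + z\<^sup>2\<close> combines with \<open>q powr (- x) = \<alpha> / z\<close> to \<open>\<alpha> (z + 1 / z)\<close>.\<close>
  have integrand: "integrand q \<alpha> a b c d x = \<alpha> * W.f a b c d x" for x
  proof -
    have z: "W.z x = \<alpha> * q powr of_real x"
      using assms(3) by (simp add: W.z_def powr_q exp_add)
    have 1: "q powr of_real (2 * x) * \<alpha>\<^sup>2 = W.z x ^ 2"
      by (simp add: z powr_q power_mult_distrib mult.assoc flip: exp_double)
    have 2: "q powr of_real (x + 1) * \<alpha> * t = q * t * W.z x" for t
      using q0 by (simp add: z powr_q ring_distribs exp_add)
    have 3: "q powr of_real (1 - x) * t / \<alpha> = q * t / W.z x" for t
      using q0 by (simp add: z powr_q ring_distribs exp_diff)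
    have 4: "q powr of_real (2 * x\<^sup>2 - x) * \<alpha> powr of_real (4 * x) = W.gauss x * \<alpha> / W.z x"
      using assms(3)
      by (simp add: z powr_q powr_def W.gauss_def exp_add exp_diff field_simps flip: exp_add exp_diff)
    have "integrand q \<alpha> a b c d x = (1 + W.z x ^ 2) * (W.P a x * W.P b x * W.P c x * W.P d x) * (W.gauss x * \<alpha> / W.z x)"
      unfolding integrand_def mult.assoc[of _ "q powr of_real (2 * x\<^sup>2 - x)"] 1 2 3 4
      by (simp add: qpochs_inf_def W.P_def Wq mult_ac)
    also have "\<dots> = \<alpha> * W.f a b c d x"
      by (simp add: W.f_def field_simps power2_eq_square)
    finally show ?thesis .
  qed
  have nz: "qpoch_inf (q * a * b * c * d) q \<noteq> 0"
    by (rule qpoch_inf_nonzero[OF assms(2) small])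
  have E: "exp (- 2 * (Ln \<alpha>)\<^sup>2 / Ln q - Ln q / 8) = exp (2 * (Ln \<alpha>)\<^sup>2 / log_inv q) / q powr (1 / 8)"
    unfolding powr_q log_inv_def exp_diff[symmetric] by simp
  have rearrange: "K * (S * (e / p) / r) / Q = S * e * K / (p * r * Q)" for K S e p r Q :: complex
    by (simp add: mult_ac)
  have "W.F a b c d = of_real (sqrt (2 * pi)) * exp (2 * (Ln \<alpha>)\<^sup>2 / log_inv q) *
      qpochs_inf [- (q * a * b), - (q * a * c), - (q * a * d),
                  - (q * b * c), - (q * b * d), - (q * c * d)] q /
      (q powr (1 / 8) * csqrt (log_inv q) * qpoch_inf (q * a * b * c * d) q)"
  proof -
    have "W.F a b c d = qpoch_inf (q * a * b * c * d) q * W.F a b c d / qpoch_inf (q * a * b * c * d) q"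
      using nz by simp
    also have "\<dots> = of_real (sqrt (2 * pi)) * exp (2 * (Ln \<alpha>)\<^sup>2 / log_inv q) *
        qpochs_inf [- (q * a * b), - (q * a * c), - (q * a * d),
                    - (q * b * c), - (q * b * d), - (q * c * d)] q /
        (q powr (1 / 8) * csqrt (log_inv q) * qpoch_inf (q * a * b * c * d) q)"
      unfolding W.F_eq[of a b c d, unfolded Wq W.F_0000 E, OF small] log_inv_def
      by (rule rearrange)
    finally show ?thesis .
  qed
  moreover have "(\<integral>x. integrand q \<alpha> a b c d x \<partial>lborel) = \<alpha> * W.F a b c d"
    by (simp add: integrand W.F_def)
  moreover have "integrable lborel (integrand q \<alpha> a b c d)"
    unfolding integrand[abs_def] using W.integrable_f[of a b c d, unfolded Wq, OF small] by simp
  ultimately show ?thesis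
    by (simp add: mult_ac)
qed

end
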